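(* Let (MICP) be $z_{IP}=\min\{f(\mathbf{x}):\mathbf{A}\mathbf{x}=\mathbf{b},\ \mathbf{x}\in X\}$ with $X=\{\mathbf{x}\in\mathbb{Z}^{n_1}\times\mathbb{R}^{n_2}:\mathbf{E}\mathbf{x}\le\mathbf{f}\}$, where $f:\mathbb{R}^n\to\mathbb{R}$ ($n=n_1+n_2$) is convex and differentiable, $\mathbf{A},\mathbf{E}$ are rational full-rank matrices and $\mathbf{b},\mathbf{f}$ are rational vectors; assume (MICP) and its continuous relaxation are feasible and have optimal solutions. Let $F_R$ be the feasible set of the continuous relaxation of (MICP), and let $\psi:\mathbb{R}^m\to\mathbb{R}_+$ be a level-bounded augmenting function. If $f$ is strongly convex or if $F_R$ is compact, then $$\lim_{\rho\to\infty}z^{LD+}_\rho=z_{IP}.$$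
   Context: $m$ is the number of rows of $\mathbf{A}$. $F_R=\{\mathbf{x}\in\mathbb{R}^n:\mathbf{A}\mathbf{x}=\mathbf{b},\ \mathbf{E}\mathbf{x}\le\mathbf{f}\}$ (here $\mathbf{f}$ is a vector, distinct from the function $f$). The augmented Lagrangian dual with penalty parameter $\rho>0$ is $$z^{LD+}_\rho=\sup_{\boldsymbol\lambda\in\mathbb{R}^m}\ \min_{\mathbf{x}\in X}\ f(\mathbf{x})+\boldsymbol\lambda^\top(\mathbf{b}-\mathbf{A}\mathbf{x})+\rho\,\psi(\mathbf{b}-\mathbf{A}\mathbf{x}),$$ with the inner minimum read as an infimum if not attained. A level-bounded augmenting function is a proper, non-negative, lower semicontinuous $\psi:\mathbb{R}^m\to\mathbb{R}_+$ with $\psi(\mathbf{0})=0$, $\psi(\mathbf{u})>0$ for $\mathbf{u}\ne\mathbf{0}$, and $\operatorname{diam}\{\mathbf{u}:\psi(\mathbf{u})\le\delta\}<+\infty$ for all $\delta>0$; moreover $\lim_{\delta\downarrow0}\operatorname{diam}\{\mathbf{u}:\psi(\mathbf{u})\le\delta\}=0$. Strongly convex means: there is $0<\mu<\infty$ with $\|\nabla f(\mathbf{x})-\nabla f(\mathbf{y})\|\ge\mu\|\mathbf{x}-\mathbf{y}\|$ for all $\mathbf{x},\mathbf{y}$ (Euclidean norm). *)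

theory Defs
  imports "HOL-Analysis.Analysis"
begin

definition rational_vec :: "real^'n \<Rightarrow> bool" where
  "rational_vec v \<longleftrightarrow> (\<forall>i. v $ i \<in> \<rat>)"

definition rational_mat :: "real^'n^'m \<Rightarrow> bool" where
  "rational_mat M \<longleftrightarrow> (\<forall>i j. M $ i $ j \<in> \<rat>)"

(* Maximal possible rank: covers both full row rank and full column rank. In particular
   E may have more rows than columns, as is needed for a bounded polyhedron. *)
definition full_rank :: "real^'n^'m \<Rightarrow> bool" where
  "full_rank M \<longleftrightarrow> rank M = min CARD('m) CARD('n)"

(* The gradient vector; meaningful where f is differentiable (see GDERIV_gradient). *)
definition gradient :: "('a::euclidean_space \<Rightarrow> real) \<Rightarrow> 'a \<Rightarrow> 'a" where
  "gradient f x = (THE D. GDERIV f x :> D)"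

lemma GDERIV_gradient:
  fixes f :: "'a::euclidean_space \<Rightarrow> real"
  assumes "f differentiable (at x)"
  shows "GDERIV f x :> gradient f x"
proof -
  obtain f' where f': "(f has_derivative f') (at x)"
    using assms by (auto simp: differentiable_def)
  then have lin: "linear f'"
    by (rule has_derivative_linear)
  have "f' = (\<lambda>h. h \<bullet> adjoint f' 1)"
  proof
    fix h
    show "f' h = h \<bullet> adjoint f' 1"
      using adjoint_works[OF lin, of h 1] by simp
  qed
  then have ex: "GDERIV f x :> adjoint f' 1"
    using f' unfolding gderiv_def by simp
  show ?thesis
    unfolding gradient_def
  proof (rule theI[where P = "\<lambda>D. GDERIV f x :> D"])
    show "GDERIV f x :> adjoint f' 1" by (rule ex)
  next
    fix D assume "GDERIV f x :> D"
    then have "(\<lambda>h. h \<bullet> D) = (\<lambda>h. h \<bullet> adjoint f' 1)"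
      using ex unfolding gderiv_def by (rule has_derivative_unique)
    then have "\<forall>h. h \<bullet> D = h \<bullet> adjoint f' 1"
      by (simp add: fun_eq_iff)
    then show "D = adjoint f' 1"
      by (simp only: vector_eq_ldot)
  qed
qed

(* To be used together with convexity and differentiability of f, which it does not include. *)
definition strongly_convex :: "('a::euclidean_space \<Rightarrow> real) \<Rightarrow> bool" where
  "strongly_convex f \<longleftrightarrow>
     (\<exists>\<mu>>0. \<forall>x y. norm (gradient f x - gradient f y) \<ge> \<mu> * norm (x - y))"

definition lower_semicontinuous :: "('a::topological_space \<Rightarrow> real) \<Rightarrow> bool" where
  "lower_semicontinuous g \<longleftrightarrow> (\<forall>u. \<forall>c < g u. eventually (\<lambda>v. c < g v) (nhds u))"

(* Properness is automatic, since psi is real-valued and non-negative. A finite diameter is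
   expressed by boundedness, because diameter is a real number (hence never infinite). *)
definition level_bounded_augmenting :: "('a::euclidean_space \<Rightarrow> real) \<Rightarrow> bool" where
  "level_bounded_augmenting \<psi> \<longleftrightarrow>
     (\<forall>u. \<psi> u \<ge> 0) \<and>
     lower_semicontinuous \<psi> \<and>
     \<psi> 0 = 0 \<and>
     (\<forall>u. u \<noteq> 0 \<longrightarrow> \<psi> u > 0) \<and>
     (\<forall>\<delta>>0. bounded {u. \<psi> u \<le> \<delta>}) \<and>
     ((\<lambda>\<delta>. diameter {u. \<psi> u \<le> \<delta>}) \<longlongrightarrow> 0) (at_right 0)"

(* I is the set of integer-constrained coordinates: n1 = card I and n2 = card (- I), either of
   which may be 0. The order of the coordinates is immaterial. *)
definition mixed_integer_set :: "'n set \<Rightarrow> real^'n^'p \<Rightarrow> real^'p \<Rightarrow> (real^'n) set" where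
  "mixed_integer_set I E h = {x. (\<forall>i\<in>I. x $ i \<in> \<int>) \<and> E *v x \<le> h}"

definition micp_feasible ::
  "'n set \<Rightarrow> real^'n^'m \<Rightarrow> real^'m \<Rightarrow> real^'n^'p \<Rightarrow> real^'p \<Rightarrow> (real^'n) set" where
  "micp_feasible I A b E h = {x. A *v x = b \<and> x \<in> mixed_integer_set I E h}"

definition relaxation_feasible ::
  "real^'n^'m \<Rightarrow> real^'m \<Rightarrow> real^'n^'p \<Rightarrow> real^'p \<Rightarrow> (real^'n) set" where
  "relaxation_feasible A b E h = {x. A *v x = b \<and> E *v x \<le> h}"

definition has_optimal_solution :: "('a \<Rightarrow> real) \<Rightarrow> 'a set \<Rightarrow> bool" where
  "has_optimal_solution f S \<longleftrightarrow> (\<exists>x. is_arg_min f (\<lambda>x. x \<in> S) x)"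

(* Optimal values are taken in the extended reals; where the minimum is attained, this is the
   minimum (see optimal_value_eq_min). *)
definition optimal_value :: "('a \<Rightarrow> real) \<Rightarrow> 'a set \<Rightarrow> ereal" where
  "optimal_value f S = (INF x\<in>S. ereal (f x))"

lemma optimal_value_eq_min:
  assumes "is_arg_min f (\<lambda>x. x \<in> S) x"
  shows "optimal_value f S = ereal (f x)"
  unfolding optimal_value_def
proof (rule antisym)
  show "(INF x\<in>S. ereal (f x)) \<le> ereal (f x)"
    using assms by (auto simp: is_arg_min_def intro: INF_lower)
  show "ereal (f x) \<le> (INF x\<in>S. ereal (f x))"
    using assms by (intro INF_greatest) (auto simp: is_arg_min_def not_less)
qed

definition augmented_lagrangian_dual ::
  "(real^'n \<Rightarrow> real) \<Rightarrow> real^'n^'m \<Rightarrow> real^'m \<Rightarrow> (real^'n) set \<Rightarrow>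
   (real^'m \<Rightarrow> real) \<Rightarrow> real \<Rightarrow> ereal" where
  "augmented_lagrangian_dual f A b X \<psi> \<rho> =
     (SUP l. optimal_value (\<lambda>x. f x + l \<bullet> (b - A *v x) + \<rho> * \<psi> (b - A *v x)) X)"

end

theory Submission
  imports Defs
begin

text \<open>It suffices to find one multiplier \<open>l\<close> for which the ordinary Lagrangian
  \<open>G x = f x + l \<bullet> (b - A x)\<close> is bounded below on \<open>X\<close> and has bounded sublevel sets on
  each slice \<open>|b - A x| \<le> r\<close>. Indeed, for \<open>c < z_IP\<close> the points violating
  \<open>c \<le> G x + \<rho> \<psi>(b - A x)\<close> then have \<open>\<psi>(b - A x) = O(1/\<rho>)\<close>, hence lie in a fixed compact
  set of infeasible points, on which the lower semicontinuous \<open>\<psi>\<close> is bounded away from 0.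
  If \<open>f\<close> is strongly convex it is coercive and \<open>l = 0\<close> works. If the feasible set of the
  relaxation is compact, so are all slices of the polyhedron, and \<open>l\<close> is a near-optimal
  multiplier of the relaxation.\<close>

section \<open>Penalty bounds from lower semicontinuity\<close>

text \<open>The open superlevel sets at positive levels cover \<open>K\<close>; the least level in a
  finite subcover works.\<close>

lemma lower_semicontinuous_bounded_away_zero:
  fixes \<psi> :: "'a::topological_space \<Rightarrow> real"
  assumes lsc: "lower_semicontinuous \<psi>" and K: "compact K" and pos: "\<And>u. u \<in> K \<Longrightarrow> \<psi> u > 0"
  shows "\<exists>\<epsilon>>0. \<forall>u\<in>K. \<psi> u > \<epsilon>"
proof -
  have op: "open {u. e < \<psi> u}" for e
    using lsc unfolding lower_semicontinuous_def
    by (subst open_subopen) (auto simp: eventually_nhds subset_eq)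
  have cover: "K \<subseteq> (\<Union>e\<in>{0<..}. {u. e < \<psi> u})"
    using pos dense by fastforce
  obtain D where D: "D \<subseteq> {0<..}" "finite D" "K \<subseteq> (\<Union>e\<in>D. {u. e < \<psi> u})"
    using compactE_image[OF K op cover] by metis
  \<comment> \<open>The extra 1 keeps the argument of \<open>Min\<close> nonempty when
    \<open>D\<close> is empty, as can happen for empty \<open>K\<close>.\<close>
  define \<epsilon> where "\<epsilon> = Min (insert 1 D)"
  have "\<epsilon> > 0" using D by (auto simp: \<epsilon>_def)
  moreover have "\<epsilon> \<le> e" if "e \<in> D" for e using D that by (auto simp: \<epsilon>_def)
  ultimately show ?thesis using D(3) by fastforce
qed

text \<open>Meant for \<open>T\<close> the constraint violation \<open>b - A x\<close>,
  \<open>G\<close> the Lagrangian at a fixed multiplier, and \<open>c\<close> any number below the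
  optimal value.\<close>

lemma eventually_penalty_ge:
  fixes T :: "'a::euclidean_space \<Rightarrow> 'b::euclidean_space" and G :: "'a \<Rightarrow> real"
  assumes X: "closed X" and T: "continuous_on UNIV T" and G: "continuous_on UNIV G"
    and \<psi>: "level_bounded_augmenting \<psi>"
    and below: "\<And>x. x \<in> X \<Longrightarrow> m \<le> G x"
    and bdd: "\<And>r. bounded {x \<in> X. G x \<le> c \<and> norm (T x) \<le> r}"
    and feas: "\<And>x. x \<in> X \<Longrightarrow> T x = 0 \<Longrightarrow> c < G x"
  shows "eventually (\<lambda>\<rho>. \<forall>x\<in>X. c \<le> G x + \<rho> * \<psi> (T x)) at_top"
proof -
  have nn: "\<psi> u \<ge> 0" and ps: "u \<noteq> 0 \<Longrightarrow> \<psi> u > 0" for u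
    using \<psi> by (auto simp: level_bounded_augmenting_def)
  have lsc: "lower_semicontinuous \<psi>" and "bounded {u. \<psi> u \<le> 1}"
    using \<psi> by (auto simp: level_bounded_augmenting_def)
  then obtain r where r: "\<And>u. \<psi> u \<le> 1 \<Longrightarrow> norm u \<le> r"
    by (auto simp: bounded_iff)
  define K where "K = {x \<in> X. G x \<le> c \<and> norm (T x) \<le> r}"
  have eq: "K = X \<inter> ({x. G x \<le> c} \<inter> {x. norm (T x) \<le> r})" by (auto simp: K_def)
  have "closed K"
    unfolding eq using X T G
    by (intro closed_Int closed_Collect_le) (auto intro!: continuous_intros)
  then have "compact K" using bdd[of r] by (simp add: compact_eq_bounded_closed K_def)
  then have "compact (T ` K)"
    by (intro compact_continuous_image continuous_on_subset[OF T]) auto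
  moreover have "\<psi> u > 0" if u: "u \<in> T ` K" for u
  proof (rule ps)
    obtain x where "x \<in> X" "G x \<le> c" "u = T x" using u by (auto simp: K_def)
    then show "u \<noteq> 0" using feas[of x] by auto
  qed
  ultimately have "\<exists>\<epsilon>>0. \<forall>u\<in>T ` K. \<psi> u > \<epsilon>"
    by (rule lower_semicontinuous_bounded_away_zero[OF lsc])
  then obtain \<epsilon> where e: "\<epsilon> > 0" "\<And>x. x \<in> K \<Longrightarrow> \<psi> (T x) > \<epsilon>"
    by auto
  \<comment> \<open>The cap 1 makes \<open>\<psi> (T x) < d\<close> imply
    \<open>norm (T x) \<le> r\<close>, hence \<open>x \<in> K\<close> once
    \<open>G x \<le> c\<close>; the cap \<open>\<epsilon>\<close> then gives the
    contradiction.\<close>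
  define d where "d = min \<epsilon> 1"
  have d: "d > 0" "d \<le> \<epsilon>" "d \<le> 1" using e by (auto simp: d_def)
  \<comment> \<open>The quotient ensures \<open>c - m \<le> \<rho> * d\<close>; the 1 keeps
    \<open>\<rho>\<close> positive even if \<open>c < m\<close>.\<close>
  have "c \<le> G x + \<rho> * \<psi> (T x)" if \<rho>: "\<rho> \<ge> max 1 ((c - m) / d)" and x: "x \<in> X" for \<rho> x
  proof (rule ccontr)
    assume neg: "\<not> c \<le> G x + \<rho> * \<psi> (T x)"
    have "0 \<le> \<rho> * \<psi> (T x)" using \<rho> nn by simp
    then have Gc: "G x \<le> c" using neg by simp
    have "(c - m) \<le> \<rho> * d" using \<rho> d by (simp add: pos_divide_le_eq)
    then have "\<rho> * \<psi> (T x) < \<rho> * d" using neg below[OF x] by linarith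
    then have "\<psi> (T x) < d" using \<rho> by simp
    moreover from this have "x \<in> K" using x Gc d r[of "T x"] by (simp add: K_def)
    ultimately show False using e(2)[of x] d by linarith
  qed
  then show ?thesis unfolding eventually_at_top_linorder by blast
qed

section \<open>Bounded slices and near-optimal multipliers\<close>

text \<open>On a ray from the feasible point \<open>x0\<close> the violation is proportional to the
  distance. By convexity the segment to a far \<open>x\<close> crosses the sphere of radius
  \<open>R\<close> inside \<open>P\<close>, where the violation is at least some
  \<open>e > 0\<close>; so violation at most \<open>r\<close> bounds the distance.\<close>

lemma bounded_slices:
  fixes T :: "'a::euclidean_space \<Rightarrow> 'b::euclidean_space"
  assumes P: "closed P" "convex P" and T: "linear T"
    and bdd: "bounded {x \<in> P. T x = b}" and x0: "x0 \<in> P" "T x0 = b"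
  shows "bounded {x \<in> P. norm (b - T x) \<le> r}"
proof -
  obtain R where R: "R > 0" "\<And>x. x \<in> P \<Longrightarrow> T x = b \<Longrightarrow> dist x0 x < R"
    using bounded_subset_ballD[OF bdd, of x0] by (auto simp: subset_eq)
  define S where "S = P \<inter> sphere x0 R"
  have "compact S" unfolding S_def using P by (auto intro: closed_Int_compact)
  moreover have "continuous_on S (\<lambda>x. norm (b - T x))"
    by (intro continuous_intros linear_continuous_on_compose[OF _ T])
  \<comment> \<open>All feasible points lie strictly inside the sphere, so the minimum of the
    violation over \<open>S\<close> is positive.\<close>
  ultimately have "\<exists>e>0. \<forall>y\<in>S. e \<le> norm (b - T y)"
  proof (cases "S = {}")
    case False
    then obtain y where y: "y \<in> S" "\<forall>z\<in>S. norm (b - T y) \<le> norm (b - T z)"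
      using continuous_attains_inf \<open>compact S\<close> \<open>continuous_on S _\<close> by meson
    have "norm (b - T y) > 0" using y(1) R(2)[of y] by (auto simp: S_def)
    then show ?thesis using y by blast
  qed (auto intro: exI[of _ 1])
  then obtain e where e: "e > 0" "\<And>y. y \<in> S \<Longrightarrow> e \<le> norm (b - T y)" by blast
  have "dist x0 x \<le> R * max 1 (r / e)" if x: "x \<in> P" and rx: "norm (b - T x) \<le> r" for x
  proof (cases "dist x0 x \<le> R")
    case True
    moreover have "R * 1 \<le> R * max 1 (r / e)" using R(1) by (intro mult_left_mono) auto
    ultimately show ?thesis by simp
  next
    case False
    then have Rx: "R < dist x0 x" "0 < dist x0 x" using R(1) by linarith+
    define s where "s = R / dist x0 x"
    have s: "0 < s" "s < 1" using Rx R(1) by (auto simp: s_def simp del: zero_less_dist_iff)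
    define y where "y = (1 - s) *\<^sub>R x0 + s *\<^sub>R x"
    have "y \<in> P" unfolding y_def using P(2) x x0 s by (auto simp: convex_def)
    moreover have "y - x0 = s *\<^sub>R (x - x0)" by (simp add: y_def algebra_simps)
    then have "dist x0 y = s * dist x0 x" using s by (simp add: dist_norm norm_minus_commute[of x0])
    then have "dist x0 y = R" using Rx by (simp add: s_def)
    ultimately have "y \<in> S" by (simp add: S_def)
    have "b - T y = s *\<^sub>R (b - T x)"
      by (simp add: y_def linear_add[OF T] linear_scale[OF T] x0(2) scaleR_diff_right)
        (simp add: algebra_simps)
    then have "e \<le> s * norm (b - T x)" using e(2)[OF \<open>y \<in> S\<close>] s by simp
    also have "\<dots> \<le> s * r" using rx s by (simp add: mult_left_mono)
    finally have "e * dist x0 x \<le> R * r"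
      using Rx(2) by (simp add: s_def pos_le_divide_eq del: zero_less_dist_iff)
    then have "dist x0 x \<le> R * (r / e)" using e(1) by (simp add: field_simps)
    also have "\<dots> \<le> R * max 1 (r / e)" using R(1) by (intro mult_left_mono) auto
    finally show ?thesis .
  qed
  then show ?thesis unfolding bounded_def by blast
qed

text \<open>Compactness of the slices makes the set of attainable pairs (constraint violation, upper
  bound on the objective) closed, so a near-optimal multiplier exists by strict separation,
  without any constraint qualification.\<close>

lemma lagrange_multiplier_exists:
  fixes T :: "'a::euclidean_space \<Rightarrow> 'b::euclidean_space" and f :: "'a \<Rightarrow> real"
  assumes P: "closed P" "convex P" and T: "linear T"
    and f: "convex_on P f" "continuous_on P f"
    and slices: "\<And>r. bounded {x \<in> P. norm (b - T x) \<le> r}"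
    and x0: "x0 \<in> P" "T x0 = b"
    and z: "\<And>x. x \<in> P \<Longrightarrow> T x = b \<Longrightarrow> z < f x"
  obtains l where "\<And>x. x \<in> P \<Longrightarrow> z \<le> f x + l \<bullet> (b - T x)"
proof -
  define C where "C = {p. \<exists>x\<in>P. fst p = b - T x \<and> f x \<le> snd p}"
  have T_cont: "continuous_on UNIV T" by (simp add: T linear_continuous_on linear_linear)
  have "convex C"
  proof (rule convexI)
    fix p q :: "'b \<times> real" and u v :: real
    assume "p \<in> C" "q \<in> C" and uv: "0 \<le> u" "0 \<le> v" "u + v = 1"
    then obtain x y where x: "x \<in> P" "fst p = b - T x" "f x \<le> snd p"
      and y: "y \<in> P" "fst q = b - T y" "f y \<le> snd q" by (auto simp: C_def)
    have "u *\<^sub>R x + v *\<^sub>R y \<in> P" using P(2) x y uv by (auto simp: convex_def)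
    moreover have "fst (u *\<^sub>R p + v *\<^sub>R q) = b - T (u *\<^sub>R x + v *\<^sub>R y)"
    proof -
      have "b = u *\<^sub>R b + v *\<^sub>R b" using uv by (simp add: scaleR_add_left[symmetric])
      then show ?thesis using x y
        by (simp add: linear_add[OF T] linear_scale[OF T] scaleR_diff_right)
    qed
    moreover have "f (u *\<^sub>R x + v *\<^sub>R y) \<le> u * f x + v * f y"
      using f(1) x y uv by (auto simp: convex_on_def)
    then have "f (u *\<^sub>R x + v *\<^sub>R y) \<le> snd (u *\<^sub>R p + v *\<^sub>R q)"
      using mult_left_mono[OF x(3) uv(1)] mult_left_mono[OF y(3) uv(2)] by simp
    ultimately show "u *\<^sub>R p + v *\<^sub>R q \<in> C" by (auto simp: C_def)
  qed
  moreover have "closed C"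
    unfolding closed_sequential_limits
  proof (intro allI impI, elim conjE)
    fix p l assume "\<forall>n. p n \<in> C" and lim: "p \<longlonglongrightarrow> l"
    then obtain x where x: "\<And>n. x n \<in> P" "\<And>n. fst (p n) = b - T (x n)" "\<And>n. f (x n) \<le> snd (p n)"
      by (auto simp: C_def) metis
    \<comment> \<open>Convergent first components keep all \<open>x n\<close> in one compact slice;
      a subsequential limit \<open>y\<close> then witnesses \<open>l \<in> C\<close>.\<close>
    have "Bseq (\<lambda>n. fst (p n))"
      using lim by (intro convergent_imp_Bseq convergentI) (rule tendsto_fst)
    then obtain r where r: "\<And>n. norm (b - T (x n)) \<le> r" by (auto simp: Bseq_def x(2))
    have "closed (P \<inter> {x. norm (b - T x) \<le> r})"
      using T_cont by (intro closed_Int P closed_Collect_le) (auto intro!: continuous_intros)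
    also have "P \<inter> {x. norm (b - T x) \<le> r} = {x \<in> P. norm (b - T x) \<le> r}" by blast
    finally have "seq_compact {x \<in> P. norm (b - T x) \<le> r}"
      using slices[of r] by (simp add: compact_eq_bounded_closed flip: compact_eq_seq_compact_metric)
    moreover have "\<forall>n. x n \<in> {x \<in> P. norm (b - T x) \<le> r}" using x r by blast
    ultimately obtain y s where y: "y \<in> P" "strict_mono s" "(x \<circ> s) \<longlonglongrightarrow> y"
      unfolding seq_compact_def by blast
    have ps: "(\<lambda>n. p (s n)) \<longlonglongrightarrow> l"
      using LIMSEQ_subseq_LIMSEQ[OF lim y(2)] by (simp add: o_def)
    have xs: "(\<lambda>n. x (s n)) \<longlonglongrightarrow> y" using y(3) by (simp add: o_def)
    have "(\<lambda>n. T (x (s n))) \<longlonglongrightarrow> T y"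
      using T_cont xs by (auto intro: continuous_on_tendsto_compose)
    then have "(\<lambda>n. fst (p (s n))) \<longlonglongrightarrow> b - T y" by (auto simp: x(2) intro: tendsto_intros)
    then have "fst l = b - T y" using tendsto_fst[OF ps] by (rule LIMSEQ_unique[rotated])
    moreover have "(\<lambda>n. f (x (s n))) \<longlonglongrightarrow> f y"
      using f(2) xs y(1) x(1) by (auto intro: continuous_on_tendsto_compose)
    then have "f y \<le> snd l" using tendsto_snd[OF ps] x(3) by (auto intro: LIMSEQ_le)
    ultimately show "l \<in> C" using y(1) by (auto simp: C_def)
  qed
  moreover have "(0, z) \<notin> C" using z by (force simp: C_def)
  ultimately obtain a \<beta> where sep: "a \<bullet> (0, z) < \<beta>" "\<And>p. p \<in> C \<Longrightarrow> a \<bullet> p > \<beta>"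
    using separating_hyperplane_closed_point[of C "(0, z)"] by blast
  obtain l s where a: "a = (l, s)" by (cases a)
  have sz: "s * z < \<beta>" using sep(1) by (simp add: a)
  have sepC: "\<beta> < l \<bullet> (b - T x) + s * t" if "x \<in> P" "f x \<le> t" for x t
    using sep(2)[of "(b - T x, t)"] that by (auto simp: C_def a)
  \<comment> \<open>The feasible point \<open>x0\<close> rules out a vertical hyperplane: since
    \<open>z < f x0\<close>, the coefficient \<open>s\<close> is positive and can be divided
    out.\<close>
  have "s * z < s * f x0" using sepC[of x0 "f x0"] x0 sz by simp
  then have s: "s > 0" using z[OF x0] by (simp add: mult_less_cancel_left)
  have "z \<le> f x + (l /\<^sub>R s) \<bullet> (b - T x)" if "x \<in> P" for x
  proof -
    have "s * z < l \<bullet> (b - T x) + s * f x" using sepC[OF that order_refl] sz by linarith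
    then show ?thesis using s by (simp add: field_simps)
  qed
  then show thesis by (rule that)
qed

section \<open>Coercivity of strongly convex functions\<close>

text \<open>Restricting \<open>f\<close> to the line through \<open>x\<close> and \<open>y\<close>
  reduces this to the one-variable tangent inequality.\<close>

lemma convex_on_ge_tangent:
  fixes f :: "'a::euclidean_space \<Rightarrow> real"
  assumes f: "convex_on UNIV f" and D: "GDERIV f x :> D"
  shows "f x + (y - x) \<bullet> D \<le> f y"
proof -
  define g where "g t = f (x + t *\<^sub>R (y - x))" for t :: real
  have "convex_on UNIV g"
  proof (rule convex_onI)
    fix t a c :: real assume t: "0 < t" "t < 1"
    have "x + ((1 - t) *\<^sub>R a + t *\<^sub>R c) *\<^sub>R (y - x)
        = (1 - t) *\<^sub>R (x + a *\<^sub>R (y - x)) + t *\<^sub>R (x + c *\<^sub>R (y - x))"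
      by (simp add: algebra_simps)
    then show "g ((1 - t) *\<^sub>R a + t *\<^sub>R c) \<le> (1 - t) * g a + t * g c"
      unfolding g_def using convex_onD[OF f] t by simp
  qed simp
  moreover have "(g has_real_derivative (y - x) \<bullet> D) (at 0)"
  proof -
    have "(f has_derivative (\<lambda>h. h \<bullet> D)) (at (x + 0 *\<^sub>R (y - x)))"
      using D by (simp add: gderiv_def)
    then have "((\<lambda>t. f (x + t *\<^sub>R (y - x))) has_derivative (\<lambda>t. (t *\<^sub>R (y - x)) \<bullet> D)) (at 0)"
      by (rule has_derivative_compose[rotated]) (auto intro!: derivative_eq_intros)
    then show ?thesis
      by (simp add: g_def[abs_def] has_field_derivative_def mult.commute[of _ "(y - x) \<bullet> D"])
  qed
  ultimately have "g 1 - g 0 \<ge> (y - x) \<bullet> D * (1 - 0)"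
    by (intro convex_on_imp_above_tangent[where A = UNIV]) auto
  then show ?thesis by (simp add: g_def)
qed

text \<open>The definition of strong convexity only says that the gradient is expansive. For a unit
  vector \<open>p\<close>, minimise the coercive function \<open>f x - p \<bullet> x + \<epsilon> |x|\<^sup>2 / 2\<close>: the first-order
  condition and expansiveness confine its minimiser to a ball independent of \<open>\<epsilon>\<close> and
  \<open>p\<close>; letting \<open>\<epsilon> \<rightarrow> 0\<close> bounds \<open>f x - p \<bullet> x\<close> from below.\<close>

lemma strongly_convex_coercive:
  fixes f :: "'a::euclidean_space \<Rightarrow> real"
  assumes f: "convex_on UNIV f" "\<forall>x. f differentiable (at x)" and sc: "strongly_convex f"
  obtains M where "\<And>y. norm y - M \<le> f y"
proof -
  obtain \<mu> where mu: "\<mu> > 0" "\<And>x y. \<mu> * norm (x - y) \<le> norm (gradient f x - gradient f y)"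
    using sc by (auto simp: strongly_convex_def)
  have D: "GDERIV f x :> gradient f x" for x using f(2) GDERIV_gradient by blast
  have cont: "continuous_on S f" for S
    using f(2) by (simp add: continuous_at_imp_continuous_on differentiable_imp_continuous_within)
  define g0 where "g0 = gradient f 0"
  \<comment> \<open>\<open>R\<close> solves \<open>\<mu> * R = 1 + \<mu> / 2 * R + norm g0\<close>,
    the estimate that the minimisers below will satisfy.\<close>
  define R where "R = 2 * (1 + norm g0) / \<mu>"
  have "R \<ge> 0" using mu by (simp add: R_def)
  obtain M0 where M0: "\<And>x. x \<in> cball 0 R \<Longrightarrow> - M0 \<le> f x"
  proof -
    have "cball (0::'a) R \<noteq> {}" using \<open>R \<ge> 0\<close> by simp
    then obtain x where "\<forall>y\<in>cball 0 R. f x \<le> f y"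
      using continuous_attains_inf[OF compact_cball _ cont] by blast
    then show thesis using that[of "- f x"] by simp
  qed
  have approx: "- (M0 + R) \<le> f y - p \<bullet> y + e / 2 * (y \<bullet> y)"
    if e: "0 < e" "e \<le> \<mu> / 2" and p: "norm p \<le> 1" for e p y
  proof -
    define F where "F x = f x - p \<bullet> x + e / 2 * (x \<bullet> x)" for x
    have Fcont: "continuous_on S F" for S
      unfolding F_def[abs_def] by (intro continuous_intros cont)
    \<comment> \<open>Beyond radius \<open>r\<close> the quadratic term outweighs \<open>p\<close>
      and the tangent of \<open>f\<close> at 0, so \<open>F\<close> is at least \<open>F 0\<close>
      there and a minimiser on the ball is global. Unlike \<open>R\<close>, \<open>r\<close> depends
      on \<open>e\<close>.\<close>
    define r where "r = 2 * (norm g0 + 1) / e"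
    have "r \<ge> 0" using e by (simp add: r_def)
    then have "cball (0::'a) r \<noteq> {}" by simp
    then obtain x where x: "x \<in> cball 0 r" "\<And>y. y \<in> cball 0 r \<Longrightarrow> F x \<le> F y"
      using continuous_attains_inf[OF compact_cball _ Fcont] by blast
    have Fmin: "F x \<le> F y" for y
    proof (cases "norm y \<le> r")
      case False
      have "f 0 + y \<bullet> g0 \<le> f y" using convex_on_ge_tangent[OF f(1) D[of 0], of y] by (simp add: g0_def)
      moreover have "\<bar>y \<bullet> g0\<bar> \<le> norm y * norm g0" by (rule Cauchy_Schwarz_ineq2)
      moreover have "\<bar>p \<bullet> y\<bar> \<le> 1 * norm y"
        using Cauchy_Schwarz_ineq2[of p y] mult_right_mono[OF p norm_ge_zero[of y]] by linarith
      moreover have "norm y * (norm g0 + 1) \<le> e / 2 * (y \<bullet> y)"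
      proof -
        have "norm g0 + 1 \<le> e / 2 * norm y" using False e by (simp add: r_def field_simps)
        then have "norm y * (norm g0 + 1) \<le> norm y * (e / 2 * norm y)" by (intro mult_left_mono) auto
        then show ?thesis by (simp add: dot_square_norm power2_eq_square algebra_simps)
      qed
      ultimately have "f 0 \<le> F y" by (simp add: F_def algebra_simps)
      moreover have "F x \<le> F 0" using x(2)[of 0] \<open>r \<ge> 0\<close> by simp
      ultimately show ?thesis by (simp add: F_def)
    qed (use x in simp)
    have "(F has_derivative (\<lambda>h. h \<bullet> gradient f x - p \<bullet> h + e / 2 * (x \<bullet> h + h \<bullet> x))) (at x)"
      unfolding F_def[abs_def] using D[of x]
      by (auto simp: gderiv_def intro!: derivative_eq_intros)
    then have "(\<lambda>h. h \<bullet> gradient f x - p \<bullet> h + e / 2 * (x \<bullet> h + h \<bullet> x)) = (\<lambda>h. 0)"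
      by (rule has_derivative_local_min) (simp add: Fmin)
    then have "h \<bullet> (gradient f x - p + e *\<^sub>R x) = 0" for h
      by (auto dest!: fun_cong[of _ _ h] simp: inner_commute algebra_simps)
    then have "gradient f x - p + e *\<^sub>R x = 0" by (metis inner_eq_zero_iff)
    then have gx: "gradient f x = p - e *\<^sub>R x" by (simp add: algebra_simps eq_diff_eq)
    \<comment> \<open>Expansiveness between \<open>x\<close> and 0; as
      \<open>e \<le> \<mu> / 2\<close>, half of the left side absorbs the term
      \<open>e * norm x\<close>.\<close>
    have "\<mu> * norm x \<le> norm (p - e *\<^sub>R x - g0)" using mu(2)[of x 0] by (simp add: gx g0_def)
    also have "\<dots> \<le> norm p + e * norm x + norm g0"
      using norm_triangle_ineq4[of "p - e *\<^sub>R x" g0] norm_triangle_ineq4[of p "e *\<^sub>R x"] e by simp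
    also have "\<dots> \<le> 1 + \<mu> / 2 * norm x + norm g0"
      using p mult_right_mono[OF e(2) norm_ge_zero[of x]] by simp
    finally have xR: "norm x \<le> R" using mu(1) by (simp add: R_def field_simps)
    have "p \<bullet> x \<le> norm p * norm x" by (rule norm_cauchy_schwarz)
    also have "\<dots> \<le> 1 * R" using p xR by (intro mult_mono) auto
    finally have "- (M0 + R) \<le> f x - p \<bullet> x" using M0[of x] xR by simp
    also have "\<dots> \<le> F x" using e by (simp add: F_def)
    also have "\<dots> \<le> F y" by (rule Fmin)
    finally show ?thesis by (simp add: F_def)
  qed
  have lower: "- (M0 + R) \<le> f y - p \<bullet> y" if p: "norm p \<le> 1" for p y
  proof (rule tendsto_lowerbound)
    show "((\<lambda>e. f y - p \<bullet> y + e / 2 * (y \<bullet> y)) \<longlongrightarrow> f y - p \<bullet> y) (at_right 0)"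
      by (auto intro!: tendsto_eq_intros)
    show "\<forall>\<^sub>F e in at_right 0. - (M0 + R) \<le> f y - p \<bullet> y + e / 2 * (y \<bullet> y)"
      unfolding eventually_at_right_field using approx[OF _ _ p] mu(1)
      by (intro exI[of _ "\<mu> / 2"]) auto
  qed simp
  \<comment> \<open>The choice \<open>p = sgn y\<close> turns \<open>p \<bullet> y\<close> into
    \<open>norm y\<close>; for \<open>y = 0\<close> both vanish.\<close>
  have "norm y - (M0 + R) \<le> f y" for y
    using lower[of "sgn y" y]
    by (cases "y = 0") (auto simp: norm_sgn sgn_div_norm dot_square_norm power2_eq_square field_simps)
  then show thesis by (rule that)
qed

section \<open>Topology and convexity of the constraint sets\<close>

lemma closed_mixed_integer_set: "closed (mixed_integer_set I E h)"
proof -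
  have "mixed_integer_set I E h = (\<Inter>i\<in>I. (\<lambda>x. x $ i) -` \<int>) \<inter> (\<Inter>j. {x. (E *v x) $ j \<le> h $ j})"
    by (auto simp: mixed_integer_set_def less_eq_vec_def)
  moreover have "closed ((\<lambda>x::real^'n. x $ i) -` \<int>)" for i
    by (intro closed_vimage closed_Ints continuous_intros)
  ultimately show ?thesis
    by (auto intro!: closed_Int closed_INT closed_Collect_le continuous_intros
        simp: matrix_vector_mult_linear_continuous_on)
qed

lemma closed_convex_polyhedron:
  shows "closed {x. (E :: real^'n^'p) *v x \<le> h}" "convex {x. E *v x \<le> h}"
proof -
  show "closed {x. E *v x \<le> h}"
    using closed_mixed_integer_set[of "{}" E h] by (simp add: mixed_integer_set_def)
  have "{x. E *v x \<le> h} = (\<lambda>x. E *v x) -` {..h}" by auto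
  moreover have "convex {..h}"
    by (auto simp: convex_def less_eq_vec_def intro!: convex_bound_le)
  ultimately show "convex {x. E *v x \<le> h}"
    by (simp add: convex_linear_vimage)
qed

section \<open>Convergence of the dual values\<close>

theorem corollary4p17:
  fixes f :: "real^'n \<Rightarrow> real"
    and A :: "real^'n^'m" and b :: "real^'m"
    and E :: "real^'n^'p" and h :: "real^'p"
    and I :: "'n set"
    and \<psi> :: "real^'m \<Rightarrow> real"
  assumes "convex_on UNIV f"
    and "\<forall>x. f differentiable (at x)"
    and "rational_mat A" and "full_rank A" and "rational_vec b"
    and "rational_mat E" and "full_rank E" and "rational_vec h"
    and "micp_feasible I A b E h \<noteq> {}"
    and "has_optimal_solution f (micp_feasible I A b E h)"
    and "relaxation_feasible A b E h \<noteq> {}"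
    and "has_optimal_solution f (relaxation_feasible A b E h)"
    and "level_bounded_augmenting \<psi>"
    and "strongly_convex f \<or> compact (relaxation_feasible A b E h)"
  shows "((\<lambda>\<rho>. augmented_lagrangian_dual f A b (mixed_integer_set I E h) \<psi> \<rho>)
           \<longlongrightarrow> optimal_value f (micp_feasible I A b E h)) at_top"
proof -
  define X where "X = mixed_integer_set I E h"
  define P where "P = {x. E *v x \<le> h}"
  define T where "T x = A *v x" for x
  have T: "linear T" unfolding T_def by simp
  then have T_cont: "continuous_on S T" for S by (simp add: linear_continuous_on linear_linear)
  have XP: "X \<subseteq> P" by (auto simp: X_def P_def mixed_integer_set_def)
  have X: "closed X" unfolding X_def by (rule closed_mixed_integer_set)
  have P: "closed P" "convex P" unfolding P_def by (rule closed_convex_polyhedron)+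
  have f_cont: "continuous_on S f" for S
    using assms(2) by (simp add: continuous_at_imp_continuous_on differentiable_imp_continuous_within)
  obtain x' where x': "is_arg_min f (\<lambda>x. x \<in> micp_feasible I A b E h) x'"
    using assms(10) by (auto simp: has_optimal_solution_def)
  have zIP: "optimal_value f (micp_feasible I A b E h) = ereal (f x')"
    using x' by (rule optimal_value_eq_min)
  have x'_feas: "x' \<in> X" "T x' = b"
    using x' by (auto simp: is_arg_min_def micp_feasible_def X_def T_def)
  have x'_min: "f x' \<le> f x" if "x \<in> X" "T x = b" for x
    using x' that by (auto simp: is_arg_min_def micp_feasible_def X_def T_def not_less)
  obtain xr where xr: "xr \<in> P" "T xr = b" and xr_min: "\<And>x. x \<in> P \<Longrightarrow> T x = b \<Longrightarrow> f xr \<le> f x"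
    using assms(12)
    by (auto simp: has_optimal_solution_def is_arg_min_def relaxation_feasible_def P_def T_def not_less)
  \<comment> \<open>Both alternatives of the last assumption serve only to supply this multiplier;
    the rest of the argument is common to them.\<close>
  have "\<exists>l m. (\<forall>x\<in>X. m \<le> f x + l \<bullet> (b - T x)) \<and>
      (\<forall>c r. bounded {x \<in> X. f x + l \<bullet> (b - T x) \<le> c \<and> norm (b - T x) \<le> r})"
    using assms(14)
  proof
    assume "strongly_convex f"
    then obtain M where M: "\<And>y. norm y - M \<le> f y"
      using strongly_convex_coercive assms(1,2) by metis
    have "- M \<le> f x" for x using M[of x] norm_ge_zero[of x] by linarith
    moreover have "bounded {x \<in> X. f x \<le> c \<and> norm (b - T x) \<le> r}" for c r
      unfolding bounded_iff by (rule exI[of _ "c + M"]) (auto simp: algebra_simps dest: order_trans[OF M])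
    ultimately show ?thesis by (intro exI[of _ 0] exI[of _ "- M"]) simp
  next
    assume "compact (relaxation_feasible A b E h)"
    then have "bounded {x \<in> P. T x = b}"
      by (simp add: compact_imp_bounded relaxation_feasible_def P_def T_def conj_commute)
    then have slices: "bounded {x \<in> P. norm (b - T x) \<le> r}" for r
      by (rule bounded_slices[OF P T _ xr])
    \<comment> \<open>The multiplier lemma wants a value strictly below the relaxation optimum; the
      gap 1 is arbitrary, since any finite lower bound \<open>m\<close> will do.\<close>
    have "f xr - 1 < f x" if "x \<in> P" "T x = b" for x using xr_min[OF that] by simp
    then obtain l where "\<And>x. x \<in> P \<Longrightarrow> f xr - 1 \<le> f x + l \<bullet> (b - T x)"
      using lagrange_multiplier_exists[OF P T convex_on_subset[OF assms(1)] f_cont slices xr] P(2)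
      by auto
    moreover have "bounded {x \<in> X. f x + l \<bullet> (b - T x) \<le> c \<and> norm (b - T x) \<le> r}" for c r
      by (rule bounded_subset[OF slices[of r]]) (use XP in auto)
    ultimately show ?thesis using XP by blast
  qed
  then obtain l m where below: "\<And>x. x \<in> X \<Longrightarrow> m \<le> f x + l \<bullet> (b - T x)"
    and bdd: "\<And>c r. bounded {x \<in> X. f x + l \<bullet> (b - T x) \<le> c \<and> norm (b - T x) \<le> r}"
    by blast
  have dual: "augmented_lagrangian_dual f A b X \<psi> \<rho> =
      (SUP l. INF x\<in>X. ereal (f x + l \<bullet> (b - T x) + \<rho> * \<psi> (b - T x)))" for \<rho>
    by (simp add: augmented_lagrangian_dual_def optimal_value_def T_def)
  \<comment> \<open>Weak duality: at the feasible \<open>x'\<close> both the multiplier term and the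
    penalty vanish.\<close>
  have upper: "augmented_lagrangian_dual f A b X \<psi> \<rho> \<le> ereal (f x')" for \<rho>
    unfolding dual
  proof (rule SUP_least)
    fix l
    have "(INF x\<in>X. ereal (f x + l \<bullet> (b - T x) + \<rho> * \<psi> (b - T x)))
        \<le> ereal (f x' + l \<bullet> (b - T x') + \<rho> * \<psi> (b - T x'))"
      by (rule INF_lower[OF x'_feas(1)])
    then show "(INF x\<in>X. ereal (f x + l \<bullet> (b - T x) + \<rho> * \<psi> (b - T x))) \<le> ereal (f x')"
      using assms(13) by (simp add: x'_feas level_bounded_augmenting_def)
  qed
  have lower: "\<forall>\<^sub>F \<rho> in at_top. ereal c \<le> augmented_lagrangian_dual f A b X \<psi> \<rho>" if c: "c < f x'" for c
  proof -
    have "\<forall>\<^sub>F \<rho> in at_top. \<forall>x\<in>X. c \<le> f x + l \<bullet> (b - T x) + \<rho> * \<psi> (b - T x)"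
    proof (rule eventually_penalty_ge[OF X _ _ assms(13) below bdd])
      show "c < f x + l \<bullet> (b - T x)" if "x \<in> X" "b - T x = 0" for x
        using x'_min[of x] that c by simp
    qed (auto intro!: continuous_intros T_cont f_cont)
    then show ?thesis
    proof eventually_elim
      case (elim \<rho>)
      \<comment> \<open>The one multiplier \<open>l\<close>, chosen independently of
        \<open>c\<close> and \<open>\<rho>\<close>, already bounds the supremum from below.\<close>
      then show ?case unfolding dual by (intro SUP_upper2[of l] INF_greatest) auto
    qed
  qed
  show ?thesis
    unfolding zIP X_def[symmetric]
  proof (rule order_tendstoI)
    fix a assume "a < ereal (f x')"
    then obtain c where "a < ereal c" "c < f x'" using ereal_dense2 by fastforce
    then show "\<forall>\<^sub>F \<rho> in at_top. a < augmented_lagrangian_dual f A b X \<psi> \<rho>"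
      using lower[of c] by (auto elim!: eventually_mono)
  next
    fix a assume "ereal (f x') < a"
    then show "\<forall>\<^sub>F \<rho> in at_top. augmented_lagrangian_dual f A b X \<psi> \<rho> < a"
      by (intro always_eventually allI order.strict_trans1[OF upper])
  qed
qed

end
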